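(* There exists a constant $K \leq 5.94$ such that for every (finite, simple) graph $G$ with at least one edge, with maximum degree $\Delta(G)$, we have $\chi_G(x) \neq 0$ for all $x \in \mathbb{C}$ with $|x| \geq K\Delta(G)$.
   Context: For a graph $G=(V,E)$, the chromatic polynomial is $\chi_G(x)=\sum_{A\subseteq E}(-1)^{|A|}x^{\kappa(A)}$, where $\kappa(A)$ is the number of connected components of the spanning subgraph $(V,A)$. $\Delta(G)$ denotes the maximum degree of $G$. *)

theory Defs
  imports Complex_Main "HOL-Computational_Algebra.Polynomial"
begin

definition simple_graph :: "'a set \<Rightarrow> 'a set set \<Rightarrow> bool" where
  "simple_graph V E \<longleftrightarrow> finite V \<and> (\<forall>e\<in>E. e \<subseteq> V \<and> card e = 2)"

definition vertex_degree :: "'a set set \<Rightarrow> 'a \<Rightarrow> nat" where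
  "vertex_degree E v = card {e \<in> E. v \<in> e}"

definition max_degree :: "'a set \<Rightarrow> 'a set set \<Rightarrow> nat" where
  "max_degree V E = Max (vertex_degree E ` V)"

text \<open>
  Two vertices are connected in \<open>(V, A)\<close> if they are joined by a (possibly empty) walk with edges
  in \<open>A\<close>. The classes of this relation are the vertex sets of the connected components of
  \<open>(V, A)\<close>; a vertex not covered by \<open>A\<close> forms a component of its own.
\<close>

definition connected_rel :: "'a set \<Rightarrow> 'a set set \<Rightarrow> ('a \<times> 'a) set" where
  "connected_rel V A = {(u, v). u \<in> V \<and> v \<in> V \<and> (u, v) \<in> {(a, b). {a, b} \<in> A}\<^sup>*}"

lemma equiv_connected_rel: "equiv V (connected_rel V A)"
proof (rule equivI)
  have "sym {(a, b). {a, b} \<in> A}"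
    by (auto simp: sym_def insert_commute)
  then have "sym ({(a, b). {a, b} \<in> A}\<^sup>*)"
    by (rule sym_rtrancl)
  then show "sym (connected_rel V A)"
    unfolding connected_rel_def sym_def by blast
  show "trans (connected_rel V A)"
    unfolding connected_rel_def trans_def by (auto intro: rtrancl_trans)
qed (auto simp: connected_rel_def refl_on_def)

definition components :: "'a set \<Rightarrow> 'a set set \<Rightarrow> 'a set set" where
  "components V A = V // connected_rel V A"

definition chromatic_poly :: "'a set \<Rightarrow> 'a set set \<Rightarrow> complex poly" where
  "chromatic_poly V E = (\<Sum>A\<in>Pow E. monom ((-1) ^ card A) (card (components V A)))"

lemma poly_chromatic_poly:
  "poly (chromatic_poly V E) x = (\<Sum>A\<in>Pow E. (-1) ^ card A * x ^ card (components V A))"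
  by (simp add: chromatic_poly_def poly_sum poly_monom)

end

theory Submission
  imports Defs
begin

text \<open>
  Put \<open>z = 1/x\<close> and \<open>F(W) = \<Sum>\<^sub>A (-1)\<^bsup>|A|\<^esup> z\<^bsup>|W| - \<kappa>(A)\<^esup>\<close>, and let \<open>C(S)\<close> be the signed count of
  the edge sets that connect \<open>S\<close>. Adding an edge \<open>uv\<close> cancels all edge sets in which \<open>u\<close> and \<open>v\<close> are
  already connected, so \<open>F\<close> becomes \<open>(1 - z) (F(W) - \<Sum>\<^sub>S C(S) z\<^bsup>|S| - 1\<^esup> F(W - S))\<close> with the sum over
  \<open>S\<close> containing \<open>u\<close> and \<open>v\<close>, and \<open>C(S)\<close> becomes \<open>- \<Sum> C(R) C(S - R)\<close> over \<open>R\<close> separating \<open>u\<close> from \<open>v\<close>.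
  Adding the edges at \<open>u\<close> one at a time, the second recursion bounds
  \<open>\<Sum> |C(S)| w\<^bsup>|S| - 1\<^esup>\<close> by a constant \<open>f\<close> over the sets containing a given vertex, and by
  \<open>h = O(1/\<Delta>)\<close> over those containing two given vertices. When the \<open>k\<close>-th edge \<open>uv\<close> is added, a set
  containing \<open>u\<close> and \<open>v\<close> must use one of the \<open>k - 1\<close> edges already present at \<open>u\<close>, so the corrections
  to \<open>F\<close> sum to only about half of what \<open>\<Delta>\<close> full corrections would give. This yields
  \<open>b |F(W - u)| \<le> |F(W)|\<close> by induction on \<open>W\<close>, hence \<open>F(V) \<noteq> 0\<close>.
\<close>

section \<open>Reachability, and splitting an edge set along a component\<close>

definition adj :: "'a set set \<Rightarrow> ('a \<times> 'a) set" where
  "adj A = {(a, b). {a, b} \<in> A}"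

definition inside :: "'a set set \<Rightarrow> 'a set \<Rightarrow> 'a set set" where
  "inside E S = {e \<in> E. e \<subseteq> S}"

text \<open>The walks may leave \<open>S\<close>. In the sums below \<open>A\<close> is inside
  \<open>S\<close>, and then this says that the graph \<open>(S, A)\<close> is connected.\<close>

definition connects :: "'a set set \<Rightarrow> 'a set \<Rightarrow> bool" where
  "connects A S \<longleftrightarrow> (\<forall>a\<in>S. \<forall>b\<in>S. (a, b) \<in> (adj A)\<^sup>*)"

text \<open>The vertex set is left out because the recursions shrink it while the edges stay
  fixed.\<close>

definition edge_set :: "'a set set \<Rightarrow> bool" where
  "edge_set E \<longleftrightarrow> finite E \<and> (\<forall>e\<in>E. card e = 2)"

lemma adj_rtrancl_sym: "(a, b) \<in> (adj A)\<^sup>* \<Longrightarrow> (b, a) \<in> (adj A)\<^sup>*"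
proof -
  have "sym (adj A)" by (auto simp: adj_def sym_def insert_commute)
  then show "(a, b) \<in> (adj A)\<^sup>* \<Longrightarrow> (b, a) \<in> (adj A)\<^sup>*"
    by (meson sym_rtrancl symD)
qed

lemma adj_rtrancl_mono: "(a, b) \<in> (adj A)\<^sup>* \<Longrightarrow> A \<subseteq> B \<Longrightarrow> (a, b) \<in> (adj B)\<^sup>*"
  by (erule rtrancl_mono[THEN subsetD, rotated]) (auto simp: adj_def)

lemma connectsI:
  assumes "\<And>b. b \<in> S \<Longrightarrow> (u, b) \<in> (adj A)\<^sup>*"
  shows "connects A S"
  unfolding connects_def using assms adj_rtrancl_sym rtrancl_trans by metis

text \<open>A walk standing in \<open>S\<close> cannot take an edge of \<open>B\<close>, because
  those lie in \<open>T\<close>, which is disjoint from \<open>S\<close>; so it never leaves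
  \<open>S\<close>.\<close>

lemma adj_rtrancl_within:
  assumes "(a, b) \<in> (adj (A \<union> B))\<^sup>*" "a \<in> S" "A \<subseteq> Pow S" "B \<subseteq> Pow T" "S \<inter> T = {}"
  shows "b \<in> S \<and> (a, b) \<in> (adj A)\<^sup>*"
  using assms(1)
proof induction
  case base
  then show ?case using assms by simp
next
  case (step y z)
  then have "{y, z} \<in> A \<or> {y, z} \<in> B" by (auto simp: adj_def)
  moreover have "{y, z} \<notin> B" using step.IH assms by blast
  ultimately have "{y, z} \<in> A" by blast
  then have "z \<in> S" "(y, z) \<in> adj A" using assms by (auto simp: adj_def)
  with step.IH show ?case by (meson rtrancl.rtrancl_into_rtrancl)
qed

lemma connects_Un_eq:
  assumes "connects A S" "u \<in> S" "A \<subseteq> Pow S" "B \<subseteq> Pow T" "S \<inter> T = {}"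
  shows "{b. (u, b) \<in> (adj (A \<union> B))\<^sup>*} = S"
proof
  show "{b. (u, b) \<in> (adj (A \<union> B))\<^sup>*} \<subseteq> S"
    using adj_rtrancl_within[OF _ assms(2-5)] by blast
  show "S \<subseteq> {b. (u, b) \<in> (adj (A \<union> B))\<^sup>*}"
    using assms(1,2) unfolding connects_def by (auto intro: adj_rtrancl_mono)
qed

text \<open>\<open>S\<close> is the component of \<open>u\<close>. The two ends of an edge of
  \<open>A\<close> lie both in \<open>S\<close> or both outside, so no edge crosses between
  \<open>S\<close> and \<open>W - S\<close>.\<close>

lemma component_split:
  assumes A: "A \<subseteq> Pow W" "\<And>e. e \<in> A \<Longrightarrow> card e = 2" and u: "u \<in> W"
    and S: "S = {b. (u, b) \<in> (adj A)\<^sup>*}"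
  shows "u \<in> S" "S \<subseteq> W" "inside A S \<union> inside A (W - S) = A" "connects (inside A S) S"
proof -
  show uS: "u \<in> S" using S by simp
  have step: "z \<in> S" if "y \<in> S" "{y, z} \<in> A" for y z
    using that S by (auto simp: adj_def intro: rtrancl.rtrancl_into_rtrancl)
  have reach: "b \<in> W \<and> (u, b) \<in> (adj (inside A S))\<^sup>*" if "(u, b) \<in> (adj A)\<^sup>*" for b
    using that
  proof induction
    case base
    then show ?case using u by simp
  next
    case (step y z)
    then have "y \<in> S" "{y, z} \<in> A" using S by (auto simp: adj_def)
    moreover from this have "z \<in> S" using \<open>\<And>z y. y \<in> S \<Longrightarrow> {y, z} \<in> A \<Longrightarrow> z \<in> S\<close> by blast
    ultimately have "(y, z) \<in> adj (inside A S)" "z \<in> W"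
      using A(1) by (auto simp: adj_def inside_def)
    with step.IH show ?case by (meson rtrancl.rtrancl_into_rtrancl)
  qed
  show "S \<subseteq> W" using reach S by blast
  show "connects (inside A S) S" using reach S by (auto intro: connectsI[where u = u])
  have "e \<subseteq> S \<or> e \<subseteq> W - S" if e: "e \<in> A" for e
  proof -
    obtain a b where ab: "e = {a, b}" using A(2)[OF e] by (auto simp: card_2_iff)
    have "a \<in> S \<longleftrightarrow> b \<in> S" using step e ab by (metis insert_commute)
    then show ?thesis using e ab A(1) by auto
  qed
  then show "inside A S \<union> inside A (W - S) = A" by (auto simp: inside_def)
qed

text \<open>Disjointness of \<open>S\<close> and \<open>T\<close> suffices because edges are
  nonempty: an empty edge would lie inside both.\<close>

lemma inside_Un_disjoint:
  assumes "A \<subseteq> inside E S" "B \<subseteq> inside E T" "S \<inter> T = {}" "edge_set E"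
  shows "inside (A \<union> B) S = A" "inside (A \<union> B) T = B" "A \<inter> B = {}"
proof -
  have "e \<noteq> {}" if "e \<in> E" for e using assms(4) that by (auto simp: edge_set_def)
  then show "inside (A \<union> B) S = A" "inside (A \<union> B) T = B" "A \<inter> B = {}"
    using assms(1-3) by (fastforce simp: inside_def)+
qed

lemma finite_inside: "edge_set E \<Longrightarrow> finite (inside E S)"
  by (simp add: edge_set_def inside_def)

lemma card_Un_inside:
  assumes "edge_set E" "A \<subseteq> inside E S" "B \<subseteq> inside E T" "S \<inter> T = {}"
  shows "card (A \<union> B) = card A + card B"
  using inside_Un_disjoint(3)[OF assms(2-4,1)] finite_inside[OF assms(1)] assms(2,3)
  by (metis card_Un_disjoint finite_subset)

text \<open>Common source of both recursions. An edge set on \<open>W\<close> is determined by the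
  component \<open>S\<close> of \<open>u\<close>, a connected edge set on \<open>S\<close> and an
  arbitrary edge set on \<open>W - S\<close>, and every such triple occurs.\<close>

lemma sum_over_component:
  fixes g :: "'a set set \<Rightarrow> 'b::comm_monoid_add"
  assumes E: "edge_set E" and W: "finite W" "u \<in> W"
  shows "(\<Sum>A\<in>Pow (inside E W). g A) =
    (\<Sum>S | u \<in> S \<and> S \<subseteq> W. \<Sum>A | A \<subseteq> inside E S \<and> connects A S.
       \<Sum>B\<in>Pow (inside E (W - S)). g (A \<union> B))"
proof -
  let ?SS = "{S. u \<in> S \<and> S \<subseteq> W}"
  let ?A = "\<lambda>S. {A. A \<subseteq> inside E S \<and> connects A S}"
  let ?B = "\<lambda>S. Pow (inside E (W - S))"
  let ?c = "\<lambda>A. {b. (u, b) \<in> (adj A)\<^sup>*}"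
  have fS: "finite ?SS" using W by simp
  have fA: "finite (?A S)" for S
    by (rule finite_subset[of _ "Pow (inside E S)"]) (auto simp: finite_inside E)
  have fB: "finite (?B S)" for S by (simp add: finite_inside E)
  have "(\<Sum>S\<in>?SS. \<Sum>A\<in>?A S. \<Sum>B\<in>?B S. g (A \<union> B)) =
      (\<Sum>S\<in>?SS. \<Sum>(A, B)\<in>?A S \<times> ?B S. g (A \<union> B))"
    by (intro sum.cong refl sum.cartesian_product)
  also have "\<dots> = (\<Sum>(S, A, B)\<in>Sigma ?SS (\<lambda>S. ?A S \<times> ?B S). g (A \<union> B))"
    using fS fA fB by (subst sum.Sigma) (auto simp: case_prod_unfold)
  also have "\<dots> = (\<Sum>A\<in>Pow (inside E W). g A)"
  proof (rule sum.reindex_bij_witness[where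
        j = "\<lambda>(S, A, B). A \<union> B" and
        i = "\<lambda>A. (?c A, inside A (?c A), inside A (W - ?c A))"])
    fix A assume "A \<in> Pow (inside E W)"
    then have A: "A \<subseteq> Pow W" "\<And>e. e \<in> A \<Longrightarrow> card e = 2" "A \<subseteq> E"
      using E by (auto simp: inside_def edge_set_def)
    note * = component_split[OF A(1,2) W(2) refl]
    show "(\<lambda>(S, A, B). A \<union> B) (?c A, inside A (?c A), inside A (W - ?c A)) = A"
      using *(3) by simp
    show "(?c A, inside A (?c A), inside A (W - ?c A)) \<in> Sigma ?SS (\<lambda>S. ?A S \<times> ?B S)"
      using * A(3) by (auto simp: inside_def)
  next
    fix x assume "x \<in> Sigma ?SS (\<lambda>S. ?A S \<times> ?B S)"
    then obtain S A B where x: "x = (S, A, B)" "u \<in> S" "S \<subseteq> W" "A \<subseteq> inside E S"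
      "connects A S" "B \<subseteq> inside E (W - S)" by auto
    have "?c (A \<union> B) = S"
      by (rule connects_Un_eq[of A S u B "W - S"]) (use x in \<open>auto simp: inside_def\<close>)
    moreover have "inside (A \<union> B) S = A" "inside (A \<union> B) (W - S) = B"
      using inside_Un_disjoint[OF x(4,6) _ E] by auto
    ultimately show "(\<lambda>A. (?c A, inside A (?c A), inside A (W - ?c A))) ((\<lambda>(S, A, B). A \<union> B) x) = x"
      using x(1) by simp
    show "(\<lambda>(S, A, B). A \<union> B) x \<in> Pow (inside E W)"
      using x by (auto simp: inside_def)
    show "g ((\<lambda>(S, A, B). A \<union> B) x) = (case x of (S, A, B) \<Rightarrow> g (A \<union> B))"
      using x(1) by simp
  qed
  finally show ?thesis by simp
qed

section \<open>Counting components\<close>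

lemma components_image: "components W A = (\<lambda>a. {b \<in> W. (a, b) \<in> (adj A)\<^sup>*}) ` W"
  by (auto simp: components_def quotient_def connected_rel_def adj_def)

lemma card_components_le: "finite W \<Longrightarrow> card (components W A) \<le> card W"
  by (simp add: components_image card_image_le)

text \<open>\<open>S\<close> is a component of its own, and the remaining components are those of
  \<open>B\<close> on \<open>W - S\<close>.\<close>

lemma card_components_split:
  assumes W: "finite W" "u \<in> S" "S \<subseteq> W"
    and A: "connects A S" "A \<subseteq> Pow S" "B \<subseteq> Pow (W - S)"
  shows "card (components W (A \<union> B)) = Suc (card (components (W - S) B))"
proof -
  have S: "{b \<in> W. (a, b) \<in> (adj (A \<union> B))\<^sup>*} = S" if "a \<in> S" for a
    using connects_Un_eq[OF A(1) that A(2,3)] W(3) by blast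
  have T: "{b \<in> W. (a, b) \<in> (adj (A \<union> B))\<^sup>*} = {b \<in> W - S. (a, b) \<in> (adj B)\<^sup>*}"
    if "a \<in> W - S" for a
  proof -
    have "b \<in> W - S \<and> (a, b) \<in> (adj B)\<^sup>*" if "(a, b) \<in> (adj (A \<union> B))\<^sup>*" for b
      using adj_rtrancl_within[of a b B A "W - S" S] that A(2,3) \<open>a \<in> W - S\<close>
      by (auto simp: Un_commute)
    then show ?thesis by (auto intro: adj_rtrancl_mono)
  qed
  have "components W (A \<union> B) = (\<lambda>a. {b \<in> W. (a, b) \<in> (adj (A \<union> B))\<^sup>*}) ` (S \<union> (W - S))"
    using W(3) by (simp add: components_image Un_absorb1)
  also have "\<dots> = insert S (components (W - S) B)"
    unfolding image_Un components_image using S T W(2) by (auto simp: image_iff)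
  finally have "components W (A \<union> B) = insert S (components (W - S) B)" .
  moreover have "S \<notin> components (W - S) B"
    using W(2) by (auto simp: components_image)
  moreover have "finite (components (W - S) B)" using W(1) by (simp add: components_image)
  ultimately show ?thesis by simp
qed

lemma adj_rtrancl_insert_same:
  assumes "(u, v) \<in> (adj A)\<^sup>*"
  shows "(adj (insert {u, v} A))\<^sup>* = (adj A)\<^sup>*"
proof
  have "adj (insert {u, v} A) \<subseteq> (adj A)\<^sup>*"
    using assms adj_rtrancl_sym[OF assms] by (auto simp: adj_def doubleton_eq_iff)
  then show "(adj (insert {u, v} A))\<^sup>* \<subseteq> (adj A)\<^sup>*"
    using rtrancl_subset_rtrancl by blast
qed (rule rtrancl_mono, auto simp: adj_def)

lemma connects_join:
  assumes "connects A S" "connects B T" "u \<in> S" "v \<in> T"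
  shows "connects (insert {u, v} (A \<union> B)) (S \<union> T)"
proof (rule connectsI[where u = u])
  let ?X = "insert {u, v} (A \<union> B)"
  fix b assume "b \<in> S \<union> T"
  then show "(u, b) \<in> (adj ?X)\<^sup>*"
  proof
    assume "b \<in> S"
    then have "(u, b) \<in> (adj A)\<^sup>*" using assms by (auto simp: connects_def)
    then show ?thesis by (rule adj_rtrancl_mono) auto
  next
    assume "b \<in> T"
    then have "(v, b) \<in> (adj B)\<^sup>*" using assms by (auto simp: connects_def)
    then have "(v, b) \<in> (adj ?X)\<^sup>*" by (rule adj_rtrancl_mono) auto
    moreover have "(u, v) \<in> adj ?X" by (simp add: adj_def)
    ultimately show ?thesis by (meson converse_rtrancl_into_rtrancl)
  qed
qed

text \<open>Without the new edge, the components \<open>S\<close> of \<open>u\<close> and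
  \<open>T\<close> of \<open>v\<close> are peeled off one after the other; with it,
  \<open>S \<union> T\<close> is peeled off as one.\<close>

lemma card_components_insert:
  assumes A: "A \<subseteq> Pow W" "\<And>e. e \<in> A \<Longrightarrow> card e = 2" and W: "finite W" "u \<in> W" "v \<in> W"
    and nc: "(u, v) \<notin> (adj A)\<^sup>*"
  shows "card (components W A) = Suc (card (components W (insert {u, v} A)))"
proof -
  define S where "S = {b. (u, b) \<in> (adj A)\<^sup>*}"
  note S = component_split[OF A W(2) S_def]
  define B where "B = inside A (W - S)"
  have B: "B \<subseteq> Pow (W - S)" "\<And>e. e \<in> B \<Longrightarrow> card e = 2" and v: "v \<in> W - S"
    using A(2) W nc by (auto simp: B_def inside_def S_def)
  define T where "T = {b. (v, b) \<in> (adj B)\<^sup>*}"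
  note T = component_split[OF B v T_def]
  define R where "R = inside B (W - S - T)"
  have SW: "inside A S \<subseteq> Pow S" "inside B T \<subseteq> Pow T" "R \<subseteq> Pow (W - S - T)"
    by (auto simp: inside_def R_def)
  have "card (components W A) = Suc (card (components (W - S) B))"
    using card_components_split[OF W(1) S(1,2,4) SW(1) B(1)] S(3) by (simp add: B_def)
  also have "card (components (W - S) B) = Suc (card (components (W - S - T) R))"
    using card_components_split[OF _ T(1,2,4) SW(2,3)] T(3) W(1) by (simp add: R_def)
  also have "Suc (card (components (W - S - T) R)) = card (components W (insert {u, v} A))"
  proof -
    have "card (components W (insert {u, v} (inside A S \<union> inside B T) \<union> R)) =
        Suc (card (components (W - (S \<union> T)) R))"
    proof (rule card_components_split[OF W(1), of u "S \<union> T"])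
      show "connects (insert {u, v} (inside A S \<union> inside B T)) (S \<union> T)"
        by (rule connects_join[OF S(4) T(4) S(1) T(1)])
    qed (use S T SW in auto)
    moreover have "insert {u, v} (inside A S \<union> inside B T) \<union> R = insert {u, v} A"
      using S(3) T(3) by (auto simp: B_def R_def)
    moreover have "W - (S \<union> T) = W - S - T" by auto
    ultimately show ?thesis by simp
  qed
  finally show ?thesis .
qed

section \<open>Recursions for adding one edge\<close>

text \<open>The \<open>C(S)\<close> of the overview: for finite nonempty \<open>S\<close>, the
  linear coefficient of the chromatic polynomial of the graph induced on \<open>S\<close>.\<close>

definition conn_sum :: "'a set set \<Rightarrow> 'a set \<Rightarrow> complex" where
  "conn_sum E S = (\<Sum>A | A \<subseteq> inside E S \<and> connects A S. (-1) ^ card A)"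

text \<open>The \<open>F(W)\<close> of the overview: the chromatic polynomial of the graph induced
  on \<open>W\<close> with its coefficients reversed. For finite \<open>W\<close> the subtraction
  does not truncate, by \<open>card_components_le\<close>.\<close>

definition rev_chrom :: "complex \<Rightarrow> 'a set set \<Rightarrow> 'a set \<Rightarrow> complex" where
  "rev_chrom z E W = (\<Sum>A\<in>Pow (inside E W). (-1) ^ card A * z ^ (card W - card (components W A)))"

lemma inside_insert: "e \<subseteq> W \<Longrightarrow> inside (insert e E) W = insert e (inside E W)"
  by (auto simp: inside_def)

lemma sum_Pow_insert:
  fixes g :: "'b set \<Rightarrow> 'c::comm_monoid_add"
  assumes "finite X" "e \<notin> X"
  shows "(\<Sum>A\<in>Pow (insert e X). g A) = (\<Sum>A\<in>Pow X. g A + g (insert e A))"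
proof -
  have "(\<Sum>A\<in>Pow (insert e X). g A) = (\<Sum>A\<in>Pow X. g A) + (\<Sum>A\<in>insert e ` Pow X. g A)"
    unfolding Pow_insert by (rule sum.union_disjoint) (use assms in auto)
  also have "(\<Sum>A\<in>insert e ` Pow X. g A) = (\<Sum>A\<in>Pow X. g (insert e A))"
    by (rule sum.reindex_cong[where l = "insert e"]) (use assms in \<open>auto simp: inj_on_def\<close>)
  finally show ?thesis by (simp add: sum.distrib)
qed

text \<open>Pair \<open>A\<close> with \<open>insert {u, v} A\<close>. If \<open>A\<close> already
  joins \<open>u\<close> to \<open>v\<close>, the two terms cancel; otherwise the new edge merges
  two components and multiplies the term by \<open>- z\<close>. The subtracted sum collects the
  \<open>A\<close> that join \<open>u\<close> to \<open>v\<close>, sorted by the component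
  \<open>S\<close> of \<open>u\<close>.\<close>

lemma rev_chrom_insert:
  assumes E: "edge_set E" and e: "{u, v} \<notin> E" "u \<noteq> v" and W: "finite W" "u \<in> W" "v \<in> W"
  shows "rev_chrom z (insert {u, v} E) W = (1 - z) * (rev_chrom z E W -
    (\<Sum>S | {u, v} \<subseteq> S \<and> S \<subseteq> W. conn_sum E S * z ^ (card S - 1) * rev_chrom z E (W - S)))"
proof -
  let ?X = "inside E W"
  let ?t = "\<lambda>A. (-1) ^ card A * z ^ (card W - card (components W A))"
  let ?p = "\<lambda>A. (u, v) \<in> (adj A)\<^sup>*"
  have eX: "{u, v} \<notin> ?X" using e by (simp add: inside_def)
  have "rev_chrom z (insert {u, v} E) W = (\<Sum>A\<in>Pow ?X. ?t A + ?t (insert {u, v} A))"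
    unfolding rev_chrom_def using W inside_insert[of "{u, v}" W E]
    by (simp add: sum_Pow_insert[OF finite_inside[OF E] eX])
  also have "\<dots> = (\<Sum>A\<in>Pow ?X. (1 - z) * (?t A - (if ?p A then ?t A else 0)))"
  proof (rule sum.cong[OF refl])
    fix A assume "A \<in> Pow ?X"
    then have A: "A \<subseteq> Pow W" "\<And>e. e \<in> A \<Longrightarrow> card e = 2" "finite A" "{u, v} \<notin> A"
      using E e finite_inside[OF E] by (auto simp: inside_def edge_set_def intro: finite_subset)
    show "?t A + ?t (insert {u, v} A) = (1 - z) * (?t A - (if ?p A then ?t A else 0))"
    proof (cases "?p A")
      case True
      then have "components W (insert {u, v} A) = components W A"
        by (simp add: components_image adj_rtrancl_insert_same)
      then show ?thesis using A True by simp
    next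
      case False
      have "card W - card (components W (insert {u, v} A)) =
          Suc (card W - card (components W A))"
        using card_components_insert[OF A(1,2) W False] card_components_le[OF W(1), of A] by simp
      then show ?thesis using A False by (simp add: algebra_simps)
    qed
  qed
  also have "\<dots> = (1 - z) * (rev_chrom z E W - (\<Sum>A\<in>Pow ?X. if ?p A then ?t A else 0))"
    by (simp add: rev_chrom_def sum_distrib_left[symmetric] sum_subtractf)
  also have "(\<Sum>A\<in>Pow ?X. if ?p A then ?t A else 0) =
      (\<Sum>S | u \<in> S \<and> S \<subseteq> W. if v \<in> S then
         conn_sum E S * z ^ (card S - 1) * rev_chrom z E (W - S) else 0)"
    unfolding sum_over_component[OF E W(1,2)]
  proof (rule sum.cong[OF refl])
    fix S assume S: "S \<in> {S. u \<in> S \<and> S \<subseteq> W}"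
    then have fS: "finite S" using W(1) finite_subset by auto
    have *: "(if ?p (A \<union> B) then ?t (A \<union> B) else 0) = (if v \<in> S then
        ((-1) ^ card A * z ^ (card S - 1)) *
        ((-1) ^ card B * z ^ (card (W - S) - card (components (W - S) B))) else 0)"
      if A: "A \<subseteq> inside E S" "connects A S" and B: "B \<subseteq> inside E (W - S)" for A B
    proof -
      have AB: "A \<subseteq> Pow S" "B \<subseteq> Pow (W - S)" using A B by (auto simp: inside_def)
      have "{b. (u, b) \<in> (adj (A \<union> B))\<^sup>*} = S"
        using connects_Un_eq[OF A(2) _ AB] S by blast
      then have p: "?p (A \<union> B) \<longleftrightarrow> v \<in> S" by blast
      have c: "card (A \<union> B) = card A + card B"
        by (rule card_Un_inside[OF E A(1) B]) blast
      have "card (components W (A \<union> B)) = Suc (card (components (W - S) B))"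
        using card_components_split[OF W(1) _ _ A(2) AB] S by blast
      moreover have "card W = card S + card (W - S)"
        using S W fS by (simp add: card_Diff_subset card_mono)
      moreover have "card (components (W - S) B) \<le> card (W - S)"
        using W(1) by (simp add: card_components_le)
      moreover have "card S > 0" using S fS by (auto simp: card_gt_0_iff)
      \<comment> \<open>\<open>S\<close> has \<open>card S\<close> vertices and is one component, so
        it contributes \<open>card S - 1\<close> to the exponent.\<close>
      ultimately have "card W - card (components W (A \<union> B)) =
          (card S - 1) + (card (W - S) - card (components (W - S) B))" by simp
      then show ?thesis using p c by (simp add: power_add)
    qed
    have "(\<Sum>A | A \<subseteq> inside E S \<and> connects A S. \<Sum>B\<in>Pow (inside E (W - S)).
        if ?p (A \<union> B) then ?t (A \<union> B) else 0) =
      (\<Sum>A | A \<subseteq> inside E S \<and> connects A S. \<Sum>B\<in>Pow (inside E (W - S)). if v \<in> S then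
        ((-1) ^ card A * z ^ (card S - 1)) *
        ((-1) ^ card B * z ^ (card (W - S) - card (components (W - S) B))) else 0)"
      using * by (intro sum.cong refl) auto
    also have "\<dots> = (if v \<in> S then
        conn_sum E S * z ^ (card S - 1) * rev_chrom z E (W - S) else 0)"
      unfolding conn_sum_def rev_chrom_def sum_distrib_right[of _ _ "z ^ (card S - 1)"] sum_product
      by (cases "v \<in> S") (simp_all only: if_True if_False sum.neutral_const)
    finally show "(\<Sum>A | A \<subseteq> inside E S \<and> connects A S. \<Sum>B\<in>Pow (inside E (W - S)).
        if ?p (A \<union> B) then ?t (A \<union> B) else 0) = (if v \<in> S then
        conn_sum E S * z ^ (card S - 1) * rev_chrom z E (W - S) else 0)" .
  qed
  also have "\<dots> = (\<Sum>S | {u, v} \<subseteq> S \<and> S \<subseteq> W.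
      conn_sum E S * z ^ (card S - 1) * rev_chrom z E (W - S))"
    using W(1) by (intro sum.mono_neutral_cong_right) auto
  finally show ?thesis .
qed

text \<open>The new edge is the only link between \<open>S\<close> and \<open>T\<close>, so a walk
  from \<open>v\<close> that leaves \<open>T\<close> can re-enter it only at \<open>v\<close>, and
  the excursion can be cut out.\<close>

lemma connects_join_iff:
  assumes A: "connects A S" "A \<subseteq> Pow S" and B: "B \<subseteq> Pow T" and "u \<in> S" "v \<in> T" "S \<inter> T = {}"
  shows "connects (insert {u, v} (A \<union> B)) (S \<union> T) \<longleftrightarrow> connects B T"
proof
  let ?X = "insert {u, v} (A \<union> B)"
  assume *: "connects ?X (S \<union> T)"
  have "y \<in> T \<longrightarrow> (v, y) \<in> (adj B)\<^sup>*" if "(v, y) \<in> (adj ?X)\<^sup>*" for y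
    using that
  proof induction
    case (step y z)
    show ?case
    proof
      assume z: "z \<in> T"
      from step(2) consider "{y, z} = {u, v}" | "{y, z} \<in> A" | "{y, z} \<in> B"
        by (auto simp: adj_def)
      then show "(v, z) \<in> (adj B)\<^sup>*"
      proof cases
        case 1
        then have "z = v" using z assms by (auto simp: doubleton_eq_iff)
        then show ?thesis by simp
      next
        case 2
        then show ?thesis using z assms by blast
      next
        case 3
        then have "y \<in> T" "(y, z) \<in> adj B" using B by (auto simp: adj_def)
        then show ?thesis using step.IH by (meson rtrancl.rtrancl_into_rtrancl)
      qed
    qed
  qed simp
  then show "connects B T"
    using * assms(5) by (intro connectsI[where u = v]) (auto simp: connects_def)
next
  assume "connects B T"
  then show "connects (insert {u, v} (A \<union> B)) (S \<union> T)"
    using A(1) assms(4,5) by (intro connects_join)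
qed

text \<open>In the same pairing, terms with \<open>A\<close> already connected cancel. The survivors
  are the \<open>A\<close> that become connected only through the new edge: they consist of a
  connected part on the component \<open>R\<close> of \<open>u\<close> and a connected part on
  \<open>S - R\<close>, which contains \<open>v\<close>. The minus sign comes from the new
  edge.\<close>

lemma conn_sum_insert:
  assumes E: "edge_set E" and e: "{u, v} \<notin> E" "u \<noteq> v" and S: "finite S" "u \<in> S" "v \<in> S"
  shows "conn_sum (insert {u, v} E) S =
    - (\<Sum>R | u \<in> R \<and> R \<subseteq> S \<and> v \<notin> R. conn_sum E R * conn_sum E (S - R))"
proof -
  let ?X = "inside E S"
  let ?s = "\<lambda>A. (-1) ^ card A :: complex"
  let ?t = "\<lambda>A. if connects A S then ?s A else 0"
  let ?d = "\<lambda>A. if connects A S then 0 else if connects (insert {u, v} A) S then - ?s A else 0"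
  have eX: "{u, v} \<notin> ?X" using e by (simp add: inside_def)
  have fin: "finite (Pow (inside (insert {u, v} E) S))"
    using finite_inside[OF E] S inside_insert[of "{u, v}" S E] by simp
  have "conn_sum (insert {u, v} E) S = (\<Sum>A\<in>Pow (inside (insert {u, v} E) S). ?t A)"
    unfolding conn_sum_def by (rule sum.mono_neutral_cong_left[OF fin]) auto
  also have "\<dots> = (\<Sum>A\<in>Pow ?X. ?t A + ?t (insert {u, v} A))"
    using S inside_insert[of "{u, v}" S E]
    by (simp add: sum_Pow_insert[OF finite_inside[OF E] eX])
  also have "\<dots> = (\<Sum>A\<in>Pow ?X. ?d A)"
  proof (rule sum.cong[OF refl])
    fix A assume A: "A \<in> Pow ?X"
    then have "finite A" "{u, v} \<notin> A"
      using e finite_inside[OF E] by (auto simp: inside_def intro: finite_subset)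
    moreover have "connects (insert {u, v} A) S" if "connects A S"
      using that unfolding connects_def by (meson adj_rtrancl_mono subset_insertI)
    ultimately show "?t A + ?t (insert {u, v} A) = ?d A" by auto
  qed
  also have "\<dots> = (\<Sum>R | u \<in> R \<and> R \<subseteq> S. if v \<notin> R then - (conn_sum E R * conn_sum E (S - R)) else 0)"
    unfolding sum_over_component[OF E S(1,2)]
  proof (rule sum.cong[OF refl])
    fix R assume R: "R \<in> {R. u \<in> R \<and> R \<subseteq> S}"
    have *: "?d (A \<union> B) = (if v \<notin> R \<and> connects B (S - R) then - (?s A * ?s B) else 0)"
      if A: "A \<subseteq> inside E R" "connects A R" and B: "B \<subseteq> inside E (S - R)" for A B
    proof -
      have AB: "A \<subseteq> Pow R" "B \<subseteq> Pow (S - R)" using A B by (auto simp: inside_def)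
      have comp: "{b. (u, b) \<in> (adj (A \<union> B))\<^sup>*} = R"
        using connects_Un_eq[OF A(2) _ AB] R by blast
      show ?thesis
      proof (cases "v \<in> R")
        case True
        then have "(u, v) \<in> (adj (A \<union> B))\<^sup>*" using comp by blast
        then show ?thesis using True by (simp add: connects_def adj_rtrancl_insert_same)
      next
        case False
        have "\<not> connects (A \<union> B) S" using False comp S unfolding connects_def by blast
        moreover have "connects (insert {u, v} (A \<union> B)) S \<longleftrightarrow> connects B (S - R)"
          using connects_join_iff[OF A(2) AB, of u v] R S False by (simp add: Un_absorb1)
        moreover have "card (A \<union> B) = card A + card B"
          by (rule card_Un_inside[OF E A(1) B]) blast
        ultimately show ?thesis using False by (simp add: power_add)
      qed
    qed
    have "(\<Sum>A | A \<subseteq> inside E R \<and> connects A R. \<Sum>B\<in>Pow (inside E (S - R)). ?d (A \<union> B)) =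
      (\<Sum>A | A \<subseteq> inside E R \<and> connects A R. \<Sum>B\<in>Pow (inside E (S - R)).
        if v \<notin> R \<and> connects B (S - R) then - (?s A * ?s B) else 0)"
      using * by (intro sum.cong refl) auto
    also have "\<dots> = (\<Sum>A | A \<subseteq> inside E R \<and> connects A R.
        \<Sum>B | B \<subseteq> inside E (S - R) \<and> connects B (S - R). if v \<notin> R then - (?s A * ?s B) else 0)"
      using finite_inside[OF E] by (intro sum.cong refl sum.mono_neutral_cong_right) auto
    also have "\<dots> = (if v \<notin> R then - (conn_sum E R * conn_sum E (S - R)) else 0)"
      by (simp add: conn_sum_def sum_product sum_negf)
    finally show "(\<Sum>A | A \<subseteq> inside E R \<and> connects A R. \<Sum>B\<in>Pow (inside E (S - R)). ?d (A \<union> B)) =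
        (if v \<notin> R then - (conn_sum E R * conn_sum E (S - R)) else 0)" .
  qed
  also have "\<dots> = (\<Sum>R | u \<in> R \<and> R \<subseteq> S \<and> v \<notin> R. - (conn_sum E R * conn_sum E (S - R)))"
    using S(1) by (intro sum.mono_neutral_cong_right) auto
  finally show ?thesis by (simp add: sum_negf)
qed

section \<open>Weighted sums of \<open>conn_sum\<close> over the sets containing given
  vertices\<close>

text \<open>Used with \<open>X\<close> a singleton or a pair; as \<open>X\<close> is then nonempty,
  so is \<open>S\<close>, and \<open>card S - 1\<close> does not truncate.\<close>

definition weight :: "real \<Rightarrow> 'a set set \<Rightarrow> 'a set \<Rightarrow> 'a set \<Rightarrow> real" where
  "weight w E W X = (\<Sum>S | X \<subseteq> S \<and> S \<subseteq> W. cmod (conn_sum E S) * w ^ (card S - 1))"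

lemma weight_nonneg: "w \<ge> 0 \<Longrightarrow> weight w E W X \<ge> 0"
  unfolding weight_def by (intro sum_nonneg) simp

lemma weight_eq_0: "\<not> X \<subseteq> W \<Longrightarrow> weight w E W X = 0"
  unfolding weight_def by (rule sum.neutral) auto

lemma conn_sum_cong: "inside E S = inside E' S \<Longrightarrow> conn_sum E S = conn_sum E' S"
  by (simp add: conn_sum_def)

lemma rev_chrom_cong: "inside E W = inside E' W \<Longrightarrow> rev_chrom z E W = rev_chrom z E' W"
  by (simp add: rev_chrom_def)

lemma inside_mono_cong:
  assumes "inside E W = inside E' W" "S \<subseteq> W"
  shows "inside E S = inside E' S"
proof -
  have "inside X S = {e \<in> inside X W. e \<subseteq> S}" for X
    using assms(2) by (auto simp: inside_def)
  then show ?thesis using assms(1) by simp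
qed

lemma weight_cong:
  assumes "inside E W = inside E' W"
  shows "weight w E W X = weight w E' W X"
  unfolding weight_def
proof (rule sum.cong[OF refl])
  fix S assume "S \<in> {S. X \<subseteq> S \<and> S \<subseteq> W}"
  then have "conn_sum E S = conn_sum E' S"
    using inside_mono_cong[OF assms, of S] by (simp add: conn_sum_def)
  then show "cmod (conn_sum E S) * w ^ (card S - 1) = cmod (conn_sum E' S) * w ^ (card S - 1)"
    by simp
qed

text \<open>Only sets containing \<open>v\<close> change. By \<open>conn_sum_insert\<close> each of
  these splits into \<open>R\<close> containing \<open>u\<close> and \<open>S - R\<close> containing
  \<open>v\<close> but not \<open>u\<close>. The vertex \<open>z\<close> lies in one of the two
  parts, which gives the two products.\<close>

lemma weight_insert:
  assumes E: "edge_set E" and e: "{u, v} \<notin> E" "u \<noteq> v" and W: "finite W" "u \<in> W" "v \<in> W"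
    and w: "w \<ge> 0"
  shows "weight w (insert {u, v} E) W {u, z} \<le>
    weight w E W {u, z} + w * (weight w E W {u, z} * weight w E (W - {u}) {v}
      + weight w E W {u} * weight w E (W - {u}) {v, z})"
proof -
  let ?c = "\<lambda>S. cmod (conn_sum E S) * w ^ (card S - 1)"
  let ?E = "insert {u, v} E"
  let ?P = "{S. {u, z} \<subseteq> S \<and> S \<subseteq> W}"
  let ?Q = "{S. {u, v, z} \<subseteq> S \<and> S \<subseteq> W}"
  let ?R = "\<lambda>S. {R. u \<in> R \<and> R \<subseteq> S \<and> v \<notin> R}"
  let ?X1 = "{S. {u, z} \<subseteq> S \<and> S \<subseteq> W} \<times> {S. {v} \<subseteq> S \<and> S \<subseteq> W - {u}}"
  let ?X2 = "{S. {u} \<subseteq> S \<and> S \<subseteq> W} \<times> {S. {v, z} \<subseteq> S \<and> S \<subseteq> W - {u}}"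
  have c0: "?c S \<ge> 0" for S using w by simp
  have fX: "finite ?X1" "finite ?X2" using W by auto
  have fP: "finite ?P" "finite ?Q" using W by auto
  have fR: "finite (?R S)" if "S \<in> ?Q" for S
    using that W by (intro finite_subset[of "?R S" "Pow W"]) auto
  have split: "cmod (conn_sum ?E S) * w ^ (card S - 1) \<le> w * (\<Sum>R\<in>?R S. ?c R * ?c (S - R))"
    if S: "S \<in> ?Q" for S
  proof -
    have fS: "finite S" "u \<in> S" "v \<in> S" using S W finite_subset by auto
    have "cmod (conn_sum ?E S) \<le> (\<Sum>R\<in>?R S. cmod (conn_sum E R) * cmod (conn_sum E (S - R)))"
      unfolding conn_sum_insert[OF E e fS] norm_minus_cancel norm_mult[symmetric] by (rule norm_sum)
    then have "cmod (conn_sum ?E S) * w ^ (card S - 1) \<le>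
        (\<Sum>R\<in>?R S. cmod (conn_sum E R) * cmod (conn_sum E (S - R)) * w ^ (card S - 1))"
      using w by (simp add: mult_right_mono flip: sum_distrib_right)
    also have "\<dots> = (\<Sum>R\<in>?R S. w * (?c R * ?c (S - R)))"
    proof (rule sum.cong[OF refl])
      fix R assume R: "R \<in> ?R S"
      then have fR: "finite R" using fS finite_subset by auto
      have "card S = card R + card (S - R)"
        using R fS fR by (simp add: card_Diff_subset card_mono)
      moreover have "card R > 0" "card (S - R) > 0" using R fS fR by (auto simp: card_gt_0_iff)
      \<comment> \<open>Two parts lose two units in the exponent where \<open>S\<close> loses one;
        this is the extra factor \<open>w\<close>.\<close>
      ultimately have "card S - 1 = Suc ((card R - 1) + (card (S - R) - 1))" by simp
      then show "cmod (conn_sum E R) * cmod (conn_sum E (S - R)) * w ^ (card S - 1) =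
          w * (?c R * ?c (S - R))"
        by (simp add: power_add)
    qed
    finally show ?thesis by (simp add: sum_distrib_left)
  qed
  have "weight w ?E W {u, z} =
      (\<Sum>S\<in>?P - ?Q. cmod (conn_sum ?E S) * w ^ (card S - 1)) +
      (\<Sum>S\<in>?Q. cmod (conn_sum ?E S) * w ^ (card S - 1))"
    unfolding weight_def by (rule sum.subset_diff) (use fP in auto)
  also have "(\<Sum>S\<in>?P - ?Q. cmod (conn_sum ?E S) * w ^ (card S - 1)) = (\<Sum>S\<in>?P - ?Q. ?c S)"
  proof (rule sum.cong[OF refl])
    fix S assume "S \<in> ?P - ?Q"
    then have "conn_sum ?E S = conn_sum E S" by (intro conn_sum_cong) (auto simp: inside_def)
    then show "cmod (conn_sum ?E S) * w ^ (card S - 1) = ?c S" by simp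
  qed
  also have "\<dots> \<le> weight w E W {u, z}"
    unfolding weight_def by (rule sum_mono2) (use fP c0 in auto)
  also have "(\<Sum>S\<in>?Q. cmod (conn_sum ?E S) * w ^ (card S - 1)) \<le>
      (\<Sum>S\<in>?Q. w * (\<Sum>R\<in>?R S. ?c R * ?c (S - R)))"
    by (rule sum_mono) (rule split)
  also have "\<dots> = w * (\<Sum>(S, R)\<in>Sigma ?Q ?R. ?c R * ?c (S - R))"
    using fP fR by (simp add: sum.Sigma flip: sum_distrib_left)
  \<comment> \<open>A pair \<open>(S, R)\<close> is recovered from \<open>(R, S - R)\<close>, so the
    double sum becomes one over pairs of disjoint sets; dropping disjointness turns the bound into
    products.\<close>
  also have "(\<Sum>(S, R)\<in>Sigma ?Q ?R. ?c R * ?c (S - R)) =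
      (\<Sum>(R, T)\<in>(\<lambda>(S, R). (R, S - R)) ` Sigma ?Q ?R. ?c R * ?c T)"
  proof (rule sum.reindex_cong[symmetric, where l = "\<lambda>(S, R). (R, S - R)"])
    show "inj_on (\<lambda>(S, R). (R, S - R)) (Sigma ?Q ?R)"
      by (rule inj_onI) (clarsimp, blast)
  qed auto
  also have "\<dots> \<le> (\<Sum>(R, T)\<in>?X1 \<union> ?X2. ?c R * ?c T)"
  proof (rule sum_mono2)
    show "finite (?X1 \<union> ?X2)" using fX by blast
    show "(\<lambda>(S, R). (R, S - R)) ` Sigma ?Q ?R \<subseteq> ?X1 \<union> ?X2" by auto
    show "0 \<le> (case x of (R, T) \<Rightarrow> ?c R * ?c T)" for x
      using c0 by (cases x) (simp only: prod.case mult_nonneg_nonneg)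
  qed
  also have "\<dots> \<le> (\<Sum>(R, T)\<in>?X1. ?c R * ?c T) + (\<Sum>(R, T)\<in>?X2. ?c R * ?c T)"
  proof -
    have "0 \<le> (\<Sum>(R, T)\<in>?X1 \<inter> ?X2. ?c R * ?c T)"
      using w by (intro sum_nonneg) auto
    then show ?thesis using sum.union_inter[OF fX, of "\<lambda>(R, T). ?c R * ?c T"] by linarith
  qed
  also have "(\<Sum>(R, T)\<in>?X1. ?c R * ?c T) = weight w E W {u, z} * weight w E (W - {u}) {v}"
    unfolding weight_def sum_product sum.cartesian_product by simp
  also have "(\<Sum>(R, T)\<in>?X2. ?c R * ?c T) = weight w E W {u} * weight w E (W - {u}) {v, z}"
    unfolding weight_def sum_product sum.cartesian_product by simp
  finally show ?thesis using w by (simp add: mult_left_mono)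
qed

lemma isolated_not_connects:
  assumes "connects A S" "u \<in> S" "S \<noteq> {u}" "\<And>e. e \<in> A \<Longrightarrow> u \<notin> e"
  shows False
proof -
  obtain b where b: "b \<in> S" "b \<noteq> u" using assms by auto
  then have "(u, b) \<in> (adj A)\<^sup>*" using assms by (auto simp: connects_def)
  then show False
    by (rule converse_rtranclE) (use b assms(4) in \<open>auto simp: adj_def\<close>)
qed

lemma conn_sum_singleton:
  assumes "edge_set E"
  shows "conn_sum E {u} = 1"
proof -
  have "inside E {u} = {}"
    using assms by (force simp: inside_def edge_set_def subset_singleton_iff)
  then have "{A. A \<subseteq> inside E {u} \<and> connects A {u}} = {{}}" by (auto simp: connects_def)
  then show ?thesis by (simp add: conn_sum_def)
qed

text \<open>The only connected set containing an isolated \<open>u\<close> is \<open>{u}\<close>.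
  This starts the inductions over the edges at \<open>u\<close>.\<close>

lemma weight_isolated:
  assumes E: "edge_set E" and iso: "\<And>e. e \<in> E \<Longrightarrow> u \<notin> e" and W: "finite W" "u \<in> W"
  shows "weight w E W {u, z} = (if z = u then 1 else 0)"
proof -
  have "conn_sum E S = 0" if "u \<in> S" "S \<noteq> {u}" for S
  proof -
    have "{A. A \<subseteq> inside E S \<and> connects A S} = {}"
      using isolated_not_connects[OF _ that] iso by (fastforce simp: inside_def)
    then show ?thesis by (simp only: conn_sum_def sum.empty)
  qed
  then have "weight w E W {u, z} =
      (\<Sum>S | {u, z} \<subseteq> S \<and> S \<subseteq> W. if S = {u} then 1 else 0)"
    unfolding weight_def by (intro sum.cong refl) (auto simp: conn_sum_singleton[OF E])
  also have "\<dots> = (if z = u then 1 else 0)" using W by (subst sum.delta) auto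
  finally show ?thesis .
qed

section \<open>Adding the edges at a vertex one at a time\<close>

text \<open>The edges at \<open>u\<close> are replaced by edges to \<open>B\<close>. Growing
  \<open>B\<close> from the empty set to the neighbourhood of \<open>u\<close> rebuilds
  \<open>E\<close>, while nothing changes on sets avoiding \<open>u\<close>.\<close>

definition star_on :: "'a set set \<Rightarrow> 'a \<Rightarrow> 'a set \<Rightarrow> 'a set set" where
  "star_on E u B = {e \<in> E. u \<notin> e} \<union> (\<lambda>v. {u, v}) ` B"

lemma star_on_empty: "star_on E u {} = {e \<in> E. u \<notin> e}"
  by (simp add: star_on_def)

lemma star_on_insert: "star_on E u (insert v B) = insert {u, v} (star_on E u B)"
  by (simp add: star_on_def)

lemma edge_set_star_on: "edge_set E \<Longrightarrow> finite B \<Longrightarrow> u \<notin> B \<Longrightarrow> edge_set (star_on E u B)"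
  by (auto simp: edge_set_def star_on_def card_2_iff)

lemma inside_star_on_avoid: "u \<notin> S \<Longrightarrow> inside (star_on E u B) S = inside E S"
  by (auto simp: inside_def star_on_def)

lemma notin_star_on: "v \<notin> B \<Longrightarrow> v \<noteq> u \<Longrightarrow> {u, v} \<notin> star_on E u B"
  by (auto simp: star_on_def doubleton_eq_iff)

lemma inside_star_on_nbrs:
  assumes "edge_set E" "u \<in> W"
  shows "inside (star_on E u {v \<in> W. {u, v} \<in> E}) W = inside E W"
proof -
  have "\<exists>v\<in>W. e = {u, v}" if "e \<in> E" "e \<subseteq> W" "u \<in> e" for e
    using that assms by (auto simp: edge_set_def card_2_iff dest!: bspec)
  then show ?thesis using assms(2) by (fastforce simp: inside_def star_on_def)
qed

lemma card_nbrs_le_degree: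
  assumes "edge_set E"
  shows "card {v \<in> W. {u, v} \<in> E} \<le> vertex_degree E u"
proof -
  have "card {v \<in> W. {u, v} \<in> E} = card ((\<lambda>v. {u, v}) ` {v \<in> W. {u, v} \<in> E})"
    by (rule card_image[symmetric]) (auto simp: inj_on_def doubleton_eq_iff)
  also have "\<dots> \<le> card {e \<in> E. u \<in> e}"
    using assms by (intro card_mono) (auto simp: edge_set_def)
  finally show ?thesis by (simp add: vertex_degree_def)
qed

text \<open>Each new edge multiplies the weight by at most \<open>1 + w * f\<close>.\<close>

lemma weight_star_on:
  assumes E: "edge_set E" and W: "finite W" "u \<in> W" and w: "w \<ge> 0"
    and B: "finite B" "B \<subseteq> W - {u}"
    and f: "\<And>v. v \<in> B \<Longrightarrow> weight w E (W - {u}) {v} \<le> f"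
  shows "weight w (star_on E u B) W {u} \<le> (1 + w * f) ^ card B"
  using B f
proof (induction B)
  case empty
  have "edge_set (star_on E u {})" "\<And>e. e \<in> star_on E u {} \<Longrightarrow> u \<notin> e"
    using edge_set_star_on[OF E, of "{}" u] by (auto simp: star_on_empty)
  from weight_isolated[OF this W, of w u] show ?case by simp
next
  case (insert v B)
  let ?E = "star_on E u B"
  have E': "edge_set ?E" using insert by (intro edge_set_star_on[OF E]) auto
  have v: "{u, v} \<notin> ?E" "u \<noteq> v" "v \<in> W" using insert notin_star_on[of v B u E] by auto
  have cong: "weight w ?E (W - {u}) X = weight w E (W - {u}) X" for X
    by (intro weight_cong inside_star_on_avoid) simp
  have m: "weight w E (W - {u}) {v} \<le> f" "weight w E (W - {u}) {v} \<ge> 0"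
    using insert weight_nonneg[OF w] by auto
  \<comment> \<open>With \<open>z = u\<close> in \<open>weight_insert\<close> the second product
    vanishes, since no subset of \<open>W - {u}\<close> contains \<open>u\<close>.\<close>
  have "weight w (insert {u, v} ?E) W {u, u} \<le>
      weight w ?E W {u} * (1 + w * weight w E (W - {u}) {v})"
    using weight_insert[OF E' v(1,2) W v(3) w, of u] weight_eq_0[of "{v, u}" "W - {u}"]
    by (simp add: cong algebra_simps)
  also have "\<dots> \<le> (1 + w * f) ^ card B * (1 + w * f)"
  proof (rule mult_mono)
    show "weight w ?E W {u} \<le> (1 + w * f) ^ card B" using insert by auto
    show "1 + w * weight w E (W - {u}) {v} \<le> 1 + w * f" using m w by (simp add: mult_left_mono)
    show "0 \<le> (1 + w * f) ^ card B" using w m by (intro zero_le_power) (simp add: add_nonneg_nonneg)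
    show "0 \<le> 1 + w * weight w E (W - {u}) {v}" using w m by (simp add: add_nonneg_nonneg)
  qed
  finally show ?case using insert by (simp add: star_on_insert mult.commute)
qed

text \<open>Each new edge \<open>{u, v}\<close> multiplies the old weight by at most
  \<open>1 + w * f\<close> and adds a term for sets in which \<open>z\<close> is reached through
  \<open>v\<close>. Here \<open>z\<close> is a vertex.\<close>

lemma weight_star_on_pair:
  assumes E: "edge_set E" and W: "finite W" "u \<in> W" and w: "w \<ge> 0"
    and B: "finite B" "B \<subseteq> W - {u}" and z: "z \<noteq> u"
    and f: "\<And>v. v \<in> B \<Longrightarrow> weight w E (W - {u}) {v} \<le> f"
  shows "weight w (star_on E u B) W {u, z} \<le>
    w * (1 + w * f) ^ card B * (\<Sum>v\<in>B. weight w E (W - {u}) {v, z})"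
  using B f
proof (induction B)
  case empty
  have "edge_set (star_on E u {})" "\<And>e. e \<in> star_on E u {} \<Longrightarrow> u \<notin> e"
    using edge_set_star_on[OF E, of "{}" u] by (auto simp: star_on_empty)
  from weight_isolated[OF this W, of w z] z show ?case by simp
next
  case (insert v B)
  let ?E = "star_on E u B"
  let ?p = "(1 + w * f) ^ card B"
  let ?s = "\<Sum>v\<in>B. weight w E (W - {u}) {v, z}"
  let ?m = "weight w E (W - {u}) {v, z}"
  have E': "edge_set ?E" using insert by (intro edge_set_star_on[OF E]) auto
  have v: "{u, v} \<notin> ?E" "u \<noteq> v" "v \<in> W" using insert notin_star_on[of v B u E] by auto
  have cong: "weight w ?E (W - {u}) X = weight w E (W - {u}) X" for X
    by (intro weight_cong inside_star_on_avoid) simp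
  have m: "weight w E (W - {u}) {v} \<le> f" "weight w E (W - {u}) {v} \<ge> 0" "?m \<ge> 0"
    using insert weight_nonneg[OF w] by auto
  have q: "1 + w * f \<ge> 1" using w m by simp
  have "?p \<ge> 1" using q by (rule one_le_power)
  have "weight w (insert {u, v} ?E) W {u, z} \<le>
      weight w ?E W {u, z} * (1 + w * weight w E (W - {u}) {v}) + w * (weight w ?E W {u} * ?m)"
    using weight_insert[OF E' v(1,2) W v(3) w, of z] by (simp add: cong algebra_simps)
  also have "\<dots> \<le> (w * ?p * ?s) * (1 + w * f) + w * (?p * ?m)"
  proof (rule add_mono[OF mult_mono])
    show "weight w ?E W {u, z} \<le> w * ?p * ?s" using insert by auto
    show "1 + w * weight w E (W - {u}) {v} \<le> 1 + w * f" using m w by (simp add: mult_left_mono)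
    have "weight w ?E W {u} \<le> ?p"
      using insert by (intro weight_star_on[OF E W w]) auto
    then show "w * (weight w ?E W {u} * ?m) \<le> w * (?p * ?m)"
      using w m by (intro mult_left_mono mult_right_mono)
    show "0 \<le> w * ?p * ?s"
      using w \<open>?p \<ge> 1\<close> by (intro mult_nonneg_nonneg sum_nonneg weight_nonneg) auto
    show "0 \<le> 1 + w * weight w E (W - {u}) {v}" using w m by (simp add: add_nonneg_nonneg)
  qed
  \<comment> \<open>A spare factor of at least 1 is given away so that all terms carry the same
    power.\<close>
  also have "w * (?p * ?m) \<le> w * (?p * (1 + w * f) * ?m)"
    using q \<open>?p \<ge> 1\<close> m(3) w by (intro mult_left_mono mult_right_mono) auto
  also have "(w * ?p * ?s) * (1 + w * f) + w * (?p * (1 + w * f) * ?m) =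
      w * (1 + w * f) ^ card (insert v B) * (\<Sum>v\<in>insert v B. weight w E (W - {u}) {v, z})"
    using insert.hyps by (simp add: algebra_simps)
  finally show ?case by (simp add: star_on_insert)
qed

section \<open>Uniform bounds for bounded degree\<close>

text \<open>The neighbours of \<open>u\<close> are weighed in \<open>W - {u}\<close>, where
  \<open>f\<close> bounds them by induction; the first assumption on \<open>f\<close> says that this
  bound reproduces itself.\<close>

lemma weight_vertex_le:
  fixes D :: nat and w f :: real
  assumes E: "edge_set E" and deg: "\<And>v. vertex_degree E v \<le> D" and w: "w \<ge> 0"
    and f: "(1 + w * f) ^ D \<le> f" "f \<ge> 0" and W: "finite W" "u \<in> W"
  shows "weight w E W {u} \<le> f"
  using W
proof (induction W arbitrary: u rule: finite_psubset_induct)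
  case (psubset W)
  let ?N = "{v \<in> W. {u, v} \<in> E}"
  have N: "finite ?N" "?N \<subseteq> W - {u}" using psubset.hyps E by (auto simp: edge_set_def)
  have "weight w E W {u} = weight w (star_on E u ?N) W {u}"
    using inside_star_on_nbrs[OF E psubset.prems] by (intro weight_cong) simp
  also have "\<dots> \<le> (1 + w * f) ^ card ?N"
  proof (rule weight_star_on[OF E _ psubset.prems w])
    show "weight w E (W - {u}) {v} \<le> f" if "v \<in> ?N" for v
      using psubset.IH[of "W - {u}" v] psubset.prems that N by auto
  qed (use psubset.hyps N in auto)
  also have "\<dots> \<le> (1 + w * f) ^ D"
    using card_nbrs_le_degree[OF E, of W u] deg[of u] w f(2) by (intro power_increasing) auto
  finally show ?case using f(1) by simp
qed

text \<open>At most one neighbour of \<open>u\<close> equals \<open>z\<close> and contributes up to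
  \<open>f\<close>; each of the others contributes at most \<open>h\<close> by induction. The first
  assumption on \<open>h\<close> closes the induction.\<close>

lemma weight_pair_le:
  fixes D :: nat and w f h :: real
  assumes E: "edge_set E" and deg: "\<And>v. vertex_degree E v \<le> D" and w: "w \<ge> 0"
    and f: "(1 + w * f) ^ D \<le> f" "f \<ge> 0" and h: "w * f * (f + D * h) \<le> h" "h \<ge> 0"
    and W: "finite W" "u \<in> W" "z \<noteq> u"
  shows "weight w E W {u, z} \<le> h"
  using W
proof (induction W arbitrary: u rule: finite_psubset_induct)
  case (psubset W)
  let ?N = "{v \<in> W. {u, v} \<in> E}"
  have N: "finite ?N" "?N \<subseteq> W - {u}" using psubset.hyps E by (auto simp: edge_set_def)
  have card: "card ?N \<le> D" using card_nbrs_le_degree[OF E, of W u] deg[of u] by linarith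
  have mf: "weight w E (W - {u}) {v} \<le> f" if "v \<in> ?N" for v
    using N that psubset.hyps by (intro weight_vertex_le[OF E deg w f]) auto
  have mh: "weight w E (W - {u}) {v, z} \<le> h" if "v \<in> ?N" "v \<noteq> z" for v
    using psubset.IH[of "W - {u}" v] psubset.prems that N by auto
  have "(\<Sum>v\<in>?N. weight w E (W - {u}) {v, z}) \<le> (\<Sum>v\<in>?N. (if v = z then f else 0) + h)"
  proof (rule sum_mono)
    fix v assume "v \<in> ?N"
    then show "weight w E (W - {u}) {v, z} \<le> (if v = z then f else 0) + h"
      using mf[of v] mh[of v] h(2) by (cases "v = z") auto
  qed
  also have "\<dots> \<le> f + D * h"
    using N card f(2) h(2) by (auto simp: sum.distrib mult_right_mono intro: add_increasing)
  finally have sum: "(\<Sum>v\<in>?N. weight w E (W - {u}) {v, z}) \<le> f + D * h" .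
  have p: "(1 + w * f) ^ card ?N \<le> f"
    using order_trans[OF power_increasing[OF card] f(1)] w f(2) by simp
  have "weight w E W {u, z} = weight w (star_on E u ?N) W {u, z}"
    using inside_star_on_nbrs[OF E psubset.prems(1)] by (intro weight_cong) simp
  also have "\<dots> \<le> w * (1 + w * f) ^ card ?N * (\<Sum>v\<in>?N. weight w E (W - {u}) {v, z})"
    by (rule weight_star_on_pair[OF E psubset.hyps psubset.prems(1) w N psubset.prems(2)])
      (rule mf)
  also have "\<dots> \<le> w * f * (f + D * h)"
    using w f(2) p sum
    by (intro mult_mono mult_left_mono sum_nonneg weight_nonneg mult_nonneg_nonneg) auto
  finally show ?case using h(1) by simp
qed

section \<open>Lower bounds for \<open>rev_chrom\<close> by removing vertices\<close>

lemma rev_chrom_empty: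
  assumes "edge_set E"
  shows "rev_chrom z E {} = 1"
proof -
  have "inside E {} = {}" using assms by (force simp: inside_def edge_set_def)
  then show ?thesis by (simp add: rev_chrom_def)
qed

text \<open>An isolated vertex adds one vertex and one component, so the exponents do not
  change.\<close>

lemma rev_chrom_isolated:
  assumes E: "edge_set E" and W: "finite W" "u \<in> W"
  shows "rev_chrom z {e \<in> E. u \<notin> e} W = rev_chrom z E (W - {u})"
proof -
  have eq: "inside {e \<in> E. u \<notin> e} W = inside E (W - {u})" by (auto simp: inside_def)
  have "card (components W A) = Suc (card (components (W - {u}) A))"
    if "A \<subseteq> inside E (W - {u})" for A
    using card_components_split[OF W(1), of u "{u}" "{}" A] W that
    by (auto simp: connects_def inside_def)
  then show ?thesis
    unfolding rev_chrom_def eq using W by (intro sum.cong refl) auto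
qed

lemma norm_rev_chrom_diff:
  assumes step: "\<And>X v. v \<in> X \<Longrightarrow> X \<subseteq> W \<Longrightarrow> b * cmod (rev_chrom z E (X - {v})) \<le> cmod (rev_chrom z E X)"
    and T: "finite T" "T \<subseteq> W" and b: "b \<ge> 0"
  shows "b ^ card T * cmod (rev_chrom z E (W - T)) \<le> cmod (rev_chrom z E W)"
  using T
proof induction
  case (insert v T)
  have "b * cmod (rev_chrom z E (W - T - {v})) \<le> cmod (rev_chrom z E (W - T))"
    using insert by (intro step) auto
  then have "b ^ card T * (b * cmod (rev_chrom z E (W - T - {v}))) \<le> cmod (rev_chrom z E W)"
    using insert b by (meson insert_subset mult_left_mono order_trans zero_le_power)
  moreover have "W - insert v T = W - T - {v}" by auto
  ultimately show ?case using insert.hyps by (simp add: mult_ac)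
qed simp

text \<open>The edge added when \<open>k\<close> edges are already present costs a factor
  \<open>1 - z\<close> and a correction of relative size at most \<open>w * f * h * k\<close>.
  Summing \<open>k\<close> below \<open>card B\<close> gives at most half of the square of
  \<open>card B\<close>, which is the gain of one half over the naive bound.\<close>

lemma norm_rev_chrom_star_on:
  fixes D :: nat and w f h b :: real
  assumes E: "edge_set E" and deg: "\<And>v. vertex_degree E v \<le> D" and w: "w \<ge> 0"
    and f: "(1 + w * f) ^ D \<le> f" "f \<ge> 0" and h: "w * f * (f + D * h) \<le> h" "h \<ge> 0"
    and W: "finite W" "u \<in> W"
    and step: "\<And>X v. v \<in> X \<Longrightarrow> X \<subseteq> W - {u} \<Longrightarrow>
        b * cmod (rev_chrom z E (X - {v})) \<le> cmod (rev_chrom z E X)"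
    and z: "cmod z \<le> w * b" "cmod z \<le> 1" and b: "b \<ge> 0"
    and B: "finite B" "B \<subseteq> W - {u}" "card B \<le> D"
  shows "(1 - card B * cmod z - w * f * h * (real (card B))\<^sup>2 / 2) * cmod (rev_chrom z E (W - {u}))
    \<le> cmod (rev_chrom z (star_on E u B) W)"
  using B
proof (induction B)
  case empty
  then show ?case using rev_chrom_isolated[OF E W] by (simp add: star_on_empty)
next
  case (insert v B)
  let ?E = "star_on E u B"
  let ?F = "cmod (rev_chrom z E (W - {u}))"
  let ?k = "real (card B)"
  let ?L = "1 - ?k * cmod z - w * f * h * ?k\<^sup>2 / 2"
  have E': "edge_set ?E" using insert by (intro edge_set_star_on[OF E]) auto
  have v: "{u, v} \<notin> ?E" "u \<noteq> v" "v \<in> W" using insert notin_star_on[of v B u E] by auto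
  \<comment> \<open>Removing the \<open>card S - 1\<close> further vertices of \<open>S\<close> from
    \<open>W - {u}\<close> costs one factor \<open>1 / b\<close> each, which
    \<open>cmod z \<le> w * b\<close> absorbs, leaving the powers of \<open>w\<close>.\<close>
  have summand: "cmod (conn_sum ?E S * z ^ (card S - 1) * rev_chrom z ?E (W - S)) \<le>
      cmod (conn_sum ?E S) * w ^ (card S - 1) * ?F" if S: "{u, v} \<subseteq> S" "S \<subseteq> W" for S
  proof -
    have "rev_chrom z ?E (W - S) = rev_chrom z E (W - {u} - (S - {u}))"
    proof -
      have "W - S = W - {u} - (S - {u})" using S by auto
      moreover have "inside ?E (W - S) = inside E (W - S)"
        using S by (intro inside_star_on_avoid) auto
      ultimately show ?thesis by (simp add: rev_chrom_def)
    qed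
    moreover have "cmod z ^ (card S - 1) * cmod (rev_chrom z E (W - {u} - (S - {u}))) \<le>
        (w * b) ^ (card S - 1) * cmod (rev_chrom z E (W - {u} - (S - {u})))"
      using z by (intro mult_right_mono power_mono) auto
    moreover have "b ^ card (S - {u}) * cmod (rev_chrom z E (W - {u} - (S - {u}))) \<le> ?F"
      using S W finite_subset[OF S(2)] by (intro norm_rev_chrom_diff[OF step _ _ b]) auto
    then have "w ^ (card S - 1) * (b ^ (card S - 1) * cmod (rev_chrom z E (W - {u} - (S - {u})))) \<le>
        w ^ (card S - 1) * ?F"
      using S w finite_subset[OF S(2) W(1)] by (intro mult_left_mono) auto
    ultimately have "cmod z ^ (card S - 1) * cmod (rev_chrom z ?E (W - S)) \<le> w ^ (card S - 1) * ?F"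
      by (simp add: power_mult_distrib mult_ac)
    then show ?thesis
      by (simp add: norm_mult norm_power mult.assoc mult_left_mono)
  qed
  let ?Q = "\<Sum>S | {u, v} \<subseteq> S \<and> S \<subseteq> W. conn_sum ?E S * z ^ (card S - 1) * rev_chrom z ?E (W - S)"
  \<comment> \<open>The edge \<open>{u, v}\<close> is not yet present, so \<open>v\<close> is
    reached through one of the \<open>card B\<close> earlier edges, each accounting for at most
    \<open>w * f * h\<close>.\<close>
  have "weight w ?E W {u, v} \<le> w * (1 + w * f) ^ card B * (\<Sum>x\<in>B. weight w E (W - {u}) {x, v})"
    using insert v W by (intro weight_star_on_pair[OF E W w] weight_vertex_le[OF E deg w f]) auto
  also have "\<dots> \<le> w * f * (\<Sum>x\<in>B. h)"
  proof (rule mult_mono[OF mult_left_mono[OF _ w] sum_mono])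
    show "(1 + w * f) ^ card B \<le> f"
      using order_trans[OF power_increasing[of "card B" D] f(1)] w f(2) insert by simp
    show "weight w E (W - {u}) {x, v} \<le> h" if "x \<in> B" for x
      using insert that W by (intro weight_pair_le[OF E deg w f h]) auto
  qed (use w f(2) in \<open>auto intro: sum_nonneg weight_nonneg\<close>)
  also have "w * f * (\<Sum>x\<in>B. h) = w * f * h * ?k" by simp
  finally have M: "weight w ?E W {u, v} \<le> w * f * h * ?k" .
  have "cmod ?Q \<le> (\<Sum>S | {u, v} \<subseteq> S \<and> S \<subseteq> W. cmod (conn_sum ?E S) * w ^ (card S - 1) * ?F)"
    by (rule sum_norm_le) (use summand in auto)
  also have "\<dots> = weight w ?E W {u, v} * ?F"
    by (simp add: weight_def sum_distrib_right)
  also have "\<dots> \<le> w * f * h * ?k * ?F"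
    using M by (rule mult_right_mono) simp
  finally have Q: "cmod ?Q \<le> w * f * h * ?k * ?F" .
  have L: "?L \<le> 1"
  proof -
    have "0 \<le> ?k * cmod z" "0 \<le> w * f * h * ?k\<^sup>2" using w f(2) h(2) by auto
    then show ?thesis by linarith
  qed
  \<comment> \<open>Since \<open>?L - w * f * h * ?k\<close> is at most 1, the factor
    \<open>1 - cmod z\<close> lowers it by at most \<open>cmod z\<close>. The square
    \<open>(?k + 1)\<^sup>2 / 2\<close> exceeds \<open>?k\<^sup>2 / 2 + ?k\<close> by one half,
    which is slack.\<close>
  have "1 - (?k + 1) * cmod z - w * f * h * (?k + 1)\<^sup>2 / 2 \<le> (1 - cmod z) * (?L - w * f * h * ?k)"
  proof -
    have p: "0 \<le> w * f * h" "0 \<le> w * f * h * ?k" using w f(2) h(2) by auto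
    have "?L - w * f * h * ?k \<le> 1" using L p(2) by linarith
    then have "cmod z * (?L - w * f * h * ?k) \<le> cmod z * 1"
      by (rule mult_left_mono) simp
    moreover have "1 - (?k + 1) * cmod z - w * f * h * (?k + 1)\<^sup>2 / 2 =
        (?L - w * f * h * ?k) - cmod z - w * f * h / 2"
      by (simp add: power2_eq_square field_simps)
    moreover have "(1 - cmod z) * (?L - w * f * h * ?k) =
        (?L - w * f * h * ?k) - cmod z * (?L - w * f * h * ?k)"
      by (simp only: left_diff_distrib mult_1)
    ultimately show ?thesis using p(1) by linarith
  qed
  then have "(1 - (?k + 1) * cmod z - w * f * h * (?k + 1)\<^sup>2 / 2) * ?F \<le>
      (1 - cmod z) * (?L - w * f * h * ?k) * ?F"
    by (rule mult_right_mono) simp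
  also have "\<dots> = (1 - cmod z) * (?L * ?F - w * f * h * ?k * ?F)"
    by (simp only: mult.assoc left_diff_distrib)
  also have "\<dots> \<le> (1 - cmod z) * (cmod (rev_chrom z ?E W) - cmod ?Q)"
    using insert Q z by (intro mult_left_mono diff_mono) auto
  \<comment> \<open>The second factor is enlarged first, because the difference of norms may be
    negative while \<open>cmod (rev_chrom z ?E W - ?Q)\<close> is not.\<close>
  also have "\<dots> \<le> cmod (1 - z) * cmod (rev_chrom z ?E W - ?Q)"
    using norm_triangle_ineq2[of 1 z] norm_triangle_ineq2[of "rev_chrom z ?E W" ?Q] z
    by (intro order_trans[OF mult_left_mono mult_right_mono]) auto
  also have "\<dots> = cmod (rev_chrom z (star_on E u (insert v B)) W)"
    using rev_chrom_insert[OF E' v(1,2) W v(3), of z] by (simp add: star_on_insert norm_mult)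
  finally show ?case using insert.hyps by (simp add: add.commute)
qed

text \<open>Induction on \<open>W\<close>: the hypothesis for subsets of \<open>W - {u}\<close> is
  the \<open>step\<close> assumption of \<open>norm_rev_chrom_star_on\<close>, and
  \<open>small\<close> ensures that the full star at \<open>u\<close> still leaves the factor
  \<open>b\<close>.\<close>

lemma norm_rev_chrom_ge:
  fixes D :: nat and w f h b :: real
  assumes E: "edge_set E" and deg: "\<And>v. vertex_degree E v \<le> D" and w: "w \<ge> 0"
    and f: "(1 + w * f) ^ D \<le> f" "f \<ge> 0" and h: "w * f * (f + D * h) \<le> h" "h \<ge> 0"
    and z: "cmod z \<le> w * b" "cmod z \<le> 1" and b: "b \<ge> 0"
    and small: "b \<le> 1 - D * cmod z - w * f * h * (real D)\<^sup>2 / 2"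
    and W: "finite W" "u \<in> W"
  shows "b * cmod (rev_chrom z E (W - {u})) \<le> cmod (rev_chrom z E W)"
  using W
proof (induction W arbitrary: u rule: finite_psubset_induct)
  case (psubset W)
  let ?N = "{v \<in> W. {u, v} \<in> E}"
  have N: "finite ?N" "?N \<subseteq> W - {u}" using psubset.hyps E by (auto simp: edge_set_def)
  have card: "card ?N \<le> D" using card_nbrs_le_degree[OF E, of W u] deg[of u] by linarith
  have "card ?N * cmod z \<le> D * cmod z" using card by (simp add: mult_right_mono)
  moreover have "w * f * h * (real (card ?N))\<^sup>2 \<le> w * f * h * (real D)\<^sup>2"
    using card w f(2) h(2) by (intro mult_left_mono power_mono) auto
  ultimately have "b \<le> 1 - card ?N * cmod z - w * f * h * (real (card ?N))\<^sup>2 / 2"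
    using small by linarith
  then have "b * cmod (rev_chrom z E (W - {u})) \<le>
      (1 - card ?N * cmod z - w * f * h * (real (card ?N))\<^sup>2 / 2) * cmod (rev_chrom z E (W - {u}))"
    by (rule mult_right_mono) simp
  also have "\<dots> \<le> cmod (rev_chrom z (star_on E u ?N) W)"
  proof (rule norm_rev_chrom_star_on[OF E deg w f h psubset.hyps psubset.prems _ z b _ _ card])
    show "b * cmod (rev_chrom z E (X - {v})) \<le> cmod (rev_chrom z E X)"
      if "v \<in> X" "X \<subseteq> W - {u}" for X v
      using psubset.IH[of X v] psubset.prems that by blast
  qed (use N in auto)
  also have "rev_chrom z (star_on E u ?N) W = rev_chrom z E W"
    using inside_star_on_nbrs[OF E psubset.prems] by (rule rev_chrom_cong)
  finally show ?case .
qed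

section \<open>Return to the chromatic polynomial and choice of constants\<close>

lemma poly_chromatic_poly_rev_chrom:
  assumes "simple_graph V E" "x \<noteq> 0"
  shows "poly (chromatic_poly V E) x = x ^ card V * rev_chrom (1 / x) E V"
proof -
  have "inside E V = E" "finite V" using assms by (auto simp: simple_graph_def inside_def)
  moreover have "x ^ card (components V A) = x ^ card V * (1 / x) ^ (card V - card (components V A))"
    for A
    using card_components_le[OF \<open>finite V\<close>, of A] assms(2)
    by (simp add: power_diff power_one_over)
  ultimately show ?thesis
    by (simp add: poly_chromatic_poly rev_chrom_def sum_distrib_left mult_ac)
qed

text \<open>Apply \<open>1 - s \<le> exp (- s)\<close> with \<open>s = 7/320\<close>, a sixteenth of
  \<open>7/20\<close>, and take the 16th power and reciprocals; this gives about 1.425.\<close>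

lemma exp_035_le: "exp (7/20 :: real) \<le> 143/100"
proof -
  have "(1 - 7/320) ^ 16 \<le> exp (- (7/320) :: real) ^ 16"
    using exp_ge_add_one_self[of "- (7/320)"] by (intro power_mono) auto
  also have "\<dots> = exp (- (7/20))"
    by (simp flip: exp_of_nat_mult)
  also have "\<dots> = inverse (exp (7/20))"
    by (rule exp_minus)
  finally have "(1 - 7/320) ^ 16 \<le> inverse (exp (7/20 :: real))" .
  then have "inverse (143/100 :: real) \<le> inverse (exp (7/20))"
    by (rule order_trans[rotated]) (simp add: power_divide)
  then show ?thesis by (rule inverse_le_imp_le) simp
qed

theorem theorem1p1:
  shows "\<exists>K::real. K \<le> 5.94 \<and>
    (\<forall>(V :: 'a set) (E :: 'a set set). simple_graph V E \<and> E \<noteq> {} \<longrightarrow>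
      (\<forall>x::complex. cmod x \<ge> K * real (max_degree V E) \<longrightarrow> poly (chromatic_poly V E) x \<noteq> 0))"
proof (intro exI[of _ "5.94::real"] conjI allI impI)
  fix V :: "'a set" and E :: "'a set set" and x :: complex
  assume G: "simple_graph V E \<and> E \<noteq> {}" and x: "5.94 * real (max_degree V E) \<le> cmod x"
  define D where "D = max_degree V E"
  have fin: "finite V" and EV: "E \<subseteq> Pow V" using G by (auto simp: simple_graph_def)
  have E: "edge_set E"
    using G finite_subset[OF EV] by (auto simp: simple_graph_def edge_set_def)
  have deg: "vertex_degree E v \<le> D" for v
  proof (cases "v \<in> V")
    case True
    then show ?thesis using fin by (simp add: D_def max_degree_def)
  next
    case False
    then have "{e \<in> E. v \<in> e} = {}" using EV by auto
    then show ?thesis by (simp only: vertex_degree_def card.empty)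
  qed
  \<comment> \<open>The existence of an edge enters here; it makes \<open>x\<close> nonzero and
    \<open>cmod z\<close> at most 1.\<close>
  have D: "real D \<ge> 1"
  proof -
    obtain e where "e \<in> E" using G by blast
    moreover from this obtain v where "v \<in> e" using E by (force simp: edge_set_def)
    ultimately have "{e \<in> E. v \<in> e} \<noteq> {}" "finite {e \<in> E. v \<in> e}" using E by (auto simp: edge_set_def)
    then have "vertex_degree E v > 0" by (auto simp: vertex_degree_def card_gt_0_iff)
    then show ?thesis using deg[of v] by simp
  qed
  have x0: "cmod x \<ge> 297/50 * D" "cmod x > 0" using x D by (auto simp: D_def)
  define w f h b :: real
    where "w = 5000 / (20493 * D)" and "f = 143/100" and "h = 20/13 * w * f\<^sup>2" and "b = 69/100"
  \<comment> \<open>\<open>w = (1/5.94) / (b D)\<close> makes \<open>|z| \<le> w b\<close>; with \<open>t = 7/20\<close>, \<open>f\<close> exceeds \<open>exp t\<close>, \<open>w D f \<le> t\<close>, and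
    \<open>h\<close> solves \<open>w f\<^sup>2 + t h = h\<close>.\<close>
  have wD: "w * D = 5000 / 20493" using D by (simp add: w_def)
  have w: "w \<ge> 0" by (simp add: w_def)
  have f: "(1 + w * f) ^ D \<le> f" "f \<ge> 0"
  proof -
    have "(1 + w * f) ^ D \<le> exp (w * f) ^ D"
      using w by (intro power_mono) (auto simp: f_def)
    also have "\<dots> = exp (w * D * f)" by (simp add: mult_ac flip: exp_of_nat_mult)
    also have "\<dots> \<le> exp (7/20)" by (simp add: wD f_def)
    finally show "(1 + w * f) ^ D \<le> f" using exp_035_le by (simp add: f_def)
  qed (simp add: f_def)
  have h0: "h \<ge> 0" using w by (simp add: h_def f_def)
  have h: "w * f * (f + D * h) \<le> h"
  proof -
    have "w * f * (f + D * h) = 13/20 * h + (w * D) * f * h"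
      by (simp add: h_def power2_eq_square algebra_simps)
    also have "\<dots> \<le> 13/20 * h + 7/20 * h"
      using h0 by (intro add_left_mono mult_right_mono) (simp_all add: wD f_def)
    finally show ?thesis by simp
  qed
  define z where "z = 1 / x"
  have Dz: "D * cmod z \<le> 50/297"
    using x0 by (simp add: z_def norm_divide field_simps)
  have zw: "cmod z \<le> w * b"
    using x0 D by (simp add: z_def norm_divide w_def b_def field_simps)
  have z1: "cmod z \<le> 1"
    using Dz mult_right_mono[OF D norm_ge_zero[of z]] by simp
  have "w * f * h * (real D)\<^sup>2 = 20/13 * (w * D)\<^sup>2 * f ^ 3"
    by (simp add: h_def power2_eq_square power3_eq_cube)
  \<comment> \<open>Numerically the right-hand side is at least about 1 - 0.1684 - 0.1339 = 0.6977,
    just above \<open>b = 0.69\<close>.\<close>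
  then have small: "b \<le> 1 - D * cmod z - w * f * h * (real D)\<^sup>2 / 2"
    using Dz by (simp add: wD f_def b_def power2_eq_square power3_eq_cube)
  \<comment> \<open>All vertices are removed, down to \<open>rev_chrom z E {} = 1\<close>.\<close>
  have "b ^ card V * cmod (rev_chrom z E (V - V)) \<le> cmod (rev_chrom z E V)"
  proof (rule norm_rev_chrom_diff)
    show "b * cmod (rev_chrom z E (X - {v})) \<le> cmod (rev_chrom z E X)"
      if "v \<in> X" "X \<subseteq> V" for X v
      using that fin finite_subset
      by (intro norm_rev_chrom_ge[OF E deg w f h h0 zw z1 _ small]) (auto simp: b_def)
  qed (use fin in \<open>auto simp: b_def\<close>)
  moreover have "b ^ card V > 0" by (simp add: b_def)
  ultimately have "rev_chrom z E V \<noteq> 0" by (auto simp: rev_chrom_empty[OF E])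
  moreover have "x \<noteq> 0" using x0 by auto
  ultimately show "poly (chromatic_poly V E) x \<noteq> 0"
    using poly_chromatic_poly_rev_chrom[of V E x] G by (simp add: z_def)
qed simp

end
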